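(* Let $b_0,b_1,b_2,\dots$ be indeterminates, $B(x)=\sum_{i\ge0}b_ix^i$, and let $g(x)$ be the unique formal power series with $g(x)=1+xg(x)B(x^2g(x))$. Let $m$ be a positive integer, let $r\ne s$ be nonnegative integers and $m_r,m_s$ nonnegative integers, and let $\left(m\,|\,b_r^{m_r}b_s^{m_s}\right)$ denote the coefficient of the monomial $b_r^{m_r}b_s^{m_s}$ in $[x^{m_r(2r+1)+m_s(2s+1)}]g^m(x)$. Then, with $k=m_r(r+1)+m_s(s+1)$, $$\left(m\,|\,b_r^{m_r}b_s^{m_s}\right)=\frac{m}{m+k-m_r-m_s}\binom{m+k-1}{m_r}\binom{m+k-1-m_r}{m_s}=\frac{m\,(m+k-1)!}{m_r!\,m_s!\,(m+k-m_r-m_s)!}.$$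
   Context: $[x^n]F(x)$ denotes the coefficient of $x^n$ in $F$. *)

theory Defs
  imports
    "HOL-Library.Poly_Mapping"
    "HOL-Computational_Algebra.Formal_Power_Series"
begin

text \<open>
  Polynomials over \<open>'a\<close> in the indeterminates \<open>b\<^sub>0, b\<^sub>1, b\<^sub>2, \<dots>\<close>: a monomial is a finitely
  supported exponent function \<open>nat \<Rightarrow>\<^sub>0 nat\<close>, a polynomial a finitely supported map from
  monomials to coefficients (with the convolution product of \<^theory>\<open>HOL-Library.Poly_Mapping\<close>).
\<close>

type_synonym 'a bpoly = "(nat \<Rightarrow>\<^sub>0 nat) \<Rightarrow>\<^sub>0 'a"

definition indet :: "nat \<Rightarrow> 'a::zero_neq_one bpoly" where
  "indet i = Poly_Mapping.single (Poly_Mapping.single i 1) 1"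

definition B_series :: "'a::zero_neq_one bpoly fps" where
  "B_series = Abs_fps indet"

definition mon2 :: "nat \<Rightarrow> nat \<Rightarrow> nat \<Rightarrow> nat \<Rightarrow> (nat \<Rightarrow>\<^sub>0 nat)" where
  "mon2 r m\<^sub>r s m\<^sub>s = Poly_Mapping.single r m\<^sub>r + Poly_Mapping.single s m\<^sub>s"

text \<open>
  The right-hand side \<open>1 + x g(x) B(x\<^sup>2 g(x))\<close> of the functional equation. The inner series
  \<open>x\<^sup>2 g(x)\<close> has zero constant term whatever \<open>g\<close> is, so \<^const>\<open>fps_compose\<close> is genuine substitution.
\<close>

definition g_rhs :: "'a::comm_ring_1 bpoly fps \<Rightarrow> 'a bpoly fps" where
  "g_rhs g = 1 + fps_X * g * fps_compose B_series (fps_X\<^sup>2 * g)"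

definition agree :: "nat \<Rightarrow> 'b fps \<Rightarrow> 'b fps \<Rightarrow> bool" where
  "agree n f h \<longleftrightarrow> (\<forall>i<n. fps_nth f i = fps_nth h i)"

lemma agree_mult:
  fixes f h p q :: "'b::comm_ring_1 fps"
  assumes "agree n f h" "agree n p q"
  shows "agree n (f * p) (h * q)"
  using assms unfolding agree_def by (auto simp: fps_mult_nth intro!: sum.cong)

lemma agree_power:
  fixes f h :: "'b::comm_ring_1 fps"
  assumes "agree n f h"
  shows "agree n (f ^ k) (h ^ k)"
proof (induction k)
  case 0
  show ?case by (simp add: agree_def)
next
  case (Suc k)
  show ?case using agree_mult[OF assms Suc] by simp
qed

lemma agree_compose:
  fixes f h p :: "'b::comm_ring_1 fps"
  assumes "agree n f h"
  shows "agree n (fps_compose p f) (fps_compose p h)"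
  using agree_power[OF assms] unfolding agree_def by (auto simp: fps_compose_nth intro!: sum.cong)

lemma agree_g_rhs:
  fixes f h :: "'a::comm_ring_1 bpoly fps"
  assumes "agree n f h"
  shows "agree (Suc n) (g_rhs f) (g_rhs h)"
proof -
  have "agree n (f * fps_compose B_series (fps_X\<^sup>2 * f)) (h * fps_compose B_series (fps_X\<^sup>2 * h))"
    by (intro agree_mult agree_compose assms) (simp add: agree_def)
  then show ?thesis
    unfolding agree_def g_rhs_def by (auto simp: mult.assoc)
qed

lemma ex1_g: "\<exists>!g :: 'a::comm_ring_1 bpoly fps. g = g_rhs g"
proof -
  define it where "it n = (g_rhs ^^ n) (0 :: 'a bpoly fps)" for n
  have it_Suc: "it (Suc n) = g_rhs (it n)" for n
    by (simp add: it_def)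
  have it_agree: "agree n (it n) (it (n + j))" for n j
  proof (induction n)
    case 0
    show ?case by (simp add: agree_def)
  next
    case (Suc n)
    show ?case using agree_g_rhs[OF Suc] by (simp add: it_Suc)
  qed
  define G where "G = Abs_fps (\<lambda>i. fps_nth (it (Suc i)) i)"
  have G_it: "agree n (it n) G" for n
    unfolding agree_def
  proof (intro allI impI)
    fix i assume "i < n"
    then obtain j where n: "n = Suc i + j"
      using less_iff_Suc_add by auto
    show "fps_nth (it n) i = fps_nth G i"
      using it_agree[of "Suc i" j] unfolding n agree_def G_def by simp
  qed
  have "G = g_rhs G"
  proof (rule fps_ext)
    fix i
    have "fps_nth (it (Suc i)) i = fps_nth (g_rhs G) i"
      using agree_g_rhs[OF G_it[of i]] by (simp add: it_Suc agree_def)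
    then show "fps_nth G i = fps_nth (g_rhs G) i"
      by (simp add: G_def)
  qed
  moreover have "f = G" if f: "f = g_rhs f" for f
  proof -
    have "agree n f G" for n
    proof (induction n)
      case 0
      show ?case by (simp add: agree_def)
    next
      case (Suc n)
      show ?case using agree_g_rhs[OF Suc] f \<open>G = g_rhs G\<close> by simp
    qed
    then show ?thesis
      unfolding agree_def fps_eq_iff by blast
  qed
  ultimately show ?thesis by blast
qed

end

theory Submission
  imports Defs
begin

text \<open>
  Multiplying the functional equation by \<open>g\<^sup>m\<close> gives
  \<open>g\<^sup>m\<^sup>+\<^sup>1 = g\<^sup>m + (\<Sum>i. b\<^sub>i x\<^sup>2\<^sup>i\<^sup>+\<^sup>1 g\<^sup>m\<^sup>+\<^sup>1\<^sup>+\<^sup>i)\<close>. Extracting the coefficient of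
  \<open>b\<^sub>r\<^sup>p b\<^sub>s\<^sup>q\<close> leaves only the summands \<open>i = r\<close> and \<open>i = s\<close>, so
  \<open>c(m+1; p, q) = c(m; p, q) + c(m+1+r; p-1, q) + c(m+1+s; p, q-1)\<close>. This recurrence determines
  the coefficients by induction on \<open>p + q\<close> and then on \<open>m\<close>, and the closed form satisfies it.
\<close>

lemma lookup_single_mult_add:
  fixes P :: "('k::cancel_comm_monoid_add) \<Rightarrow>\<^sub>0 ('a::semiring_0)"
  shows "Poly_Mapping.lookup (Poly_Mapping.single t c * P) (t + u) = c * Poly_Mapping.lookup P u"
  by (simp add: lookup_mult lookup_single when_mult)

lemma lookup_single_mult_eq_0:
  fixes P :: "('k::cancel_comm_monoid_add) \<Rightarrow>\<^sub>0 ('a::semiring_0)"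
  assumes "\<And>u. v \<noteq> t + u"
  shows "Poly_Mapping.lookup (Poly_Mapping.single t c * P) v = 0"
  using assms by (simp add: lookup_mult lookup_single when_mult)

lemma lookup_indet_mult_mon2_left:
  fixes P :: "'a::comm_ring_1 bpoly"
  shows "Poly_Mapping.lookup (indet r * P) (mon2 r (Suc p) s q) = Poly_Mapping.lookup P (mon2 r p s q)"
proof -
  have "mon2 r (Suc p) s q = Poly_Mapping.single r 1 + mon2 r p s q"
    by (simp add: mon2_def single_add[symmetric] add.assoc[symmetric])
  then show ?thesis
    by (simp add: indet_def lookup_single_mult_add)
qed

lemma mon2_commute: "mon2 r p s q = mon2 s q r p"
  by (simp add: mon2_def add.commute)

lemma lookup_indet_mult_eq_0:
  fixes P :: "'a::comm_ring_1 bpoly"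
  assumes "Poly_Mapping.lookup v i = 0"
  shows "Poly_Mapping.lookup (indet i * P) v = 0"
  unfolding indet_def
proof (rule lookup_single_mult_eq_0)
  fix u
  show "v \<noteq> Poly_Mapping.single i 1 + u"
    using assms by (auto simp: lookup_add)
qed

text \<open>As \<open>u\<close> has no constant term, \<open>u ^ i\<close> starts at degree
  \<open>i\<close> or later. So for every \<open>j\<close> up to \<open>n\<close> the coefficient of
  the composite may be summed over the common range \<open>i \<le> n\<close>, which lets the two
  sums be swapped.\<close>

lemma fps_mult_compose_nth:
  fixes a h u :: "'a::comm_ring_1 fps"
  assumes "fps_nth u 0 = 0"
  shows "fps_nth (h * fps_compose a u) n = (\<Sum>i\<le>n. fps_nth a i * fps_nth (h * u ^ i) n)"
proof -
  have "fps_nth (fps_compose a u) j = (\<Sum>i\<le>n. fps_nth a i * fps_nth (u ^ i) j)" if "j \<le> n" for j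
    unfolding fps_compose_nth using that startsby_zero_power_prefix[OF assms]
    by (intro sum.mono_neutral_left) auto
  then have "fps_nth (h * fps_compose a u) n
      = (\<Sum>j=0..n. \<Sum>i\<le>n. fps_nth a i * (fps_nth h j * fps_nth (u ^ i) (n - j)))"
    by (simp add: fps_mult_nth sum_distrib_left mult.left_commute)
  also have "\<dots> = (\<Sum>i\<le>n. fps_nth a i * fps_nth (h * u ^ i) n)"
    by (subst sum.swap) (simp add: fps_mult_nth sum_distrib_left)
  finally show ?thesis .
qed

lemma fps_power_Suc_nth_recurrence:
  fixes g :: "'a::comm_ring_1 bpoly fps"
  assumes g: "g = 1 + fps_X * g * fps_compose B_series (fps_X\<^sup>2 * g)"
  shows "fps_nth (g ^ Suc m) n = fps_nth (g ^ m) n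
    + (\<Sum>i\<le>n. indet i * (if n < 2 * i + 1 then 0 else fps_nth (g ^ (Suc m + i)) (n - (2 * i + 1))))"
proof -
  \<comment> \<open>Source of the weight \<open>2 * i + 1\<close> of \<open>indet i\<close>: one
    factor \<open>fps_X\<close> in front and two from each factor of the \<open>i\<close>-th
    power.\<close>
  have pw: "(fps_X * g ^ Suc m) * (fps_X\<^sup>2 * g) ^ i = fps_X ^ (2 * i + 1) * g ^ (Suc m + i)" for i
    by (simp add: power_mult_distrib power_add ac_simps flip: power_mult)
  have "g ^ Suc m = g ^ m * (1 + fps_X * g * fps_compose B_series (fps_X\<^sup>2 * g))"
    using g by (metis power_Suc2)
  also have "\<dots> = g ^ m + (fps_X * g ^ Suc m) * fps_compose B_series (fps_X\<^sup>2 * g)"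
    by (simp add: algebra_simps)
  finally have "fps_nth (g ^ Suc m) n
      = fps_nth (g ^ m) n + fps_nth ((fps_X * g ^ Suc m) * fps_compose B_series (fps_X\<^sup>2 * g)) n"
    by (metis fps_add_nth)
  also have "\<dots> = fps_nth (g ^ m) n
      + (\<Sum>i\<le>n. indet i * fps_nth ((fps_X * g ^ Suc m) * (fps_X\<^sup>2 * g) ^ i) n)"
    by (subst fps_mult_compose_nth) (simp_all add: B_series_def)
  finally show ?thesis
    by (simp only: pw fps_X_power_mult_nth)
qed

text \<open>In the recurrence \<open>indet i\<close> always comes with degree
  \<open>2 * i + 1\<close> in \<open>x\<close>, so the degree to extract is fixed by the
  monomial.\<close>

definition mon2_coeff :: "'a::comm_ring_1 bpoly fps \<Rightarrow> nat \<Rightarrow> nat \<Rightarrow> nat \<Rightarrow> nat \<Rightarrow> nat \<Rightarrow> 'a" where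
  "mon2_coeff g r s m p q =
     Poly_Mapping.lookup (fps_nth (g ^ m) (p * (2 * r + 1) + q * (2 * s + 1))) (mon2 r p s q)"

lemma mon2_coeff_Suc:
  fixes g :: "'a::comm_ring_1 bpoly fps"
  assumes g: "g = 1 + fps_X * g * fps_compose B_series (fps_X\<^sup>2 * g)" and rs: "r \<noteq> s"
  shows "mon2_coeff g r s (Suc m) p q = mon2_coeff g r s m p q
     + (if p = 0 then 0 else mon2_coeff g r s (Suc m + r) (p - 1) q)
     + (if q = 0 then 0 else mon2_coeff g r s (Suc m + s) p (q - 1))"
proof -
  define n where "n = p * (2 * r + 1) + q * (2 * s + 1)"
  define T where "T i = Poly_Mapping.lookup (indet i *
     (if n < 2 * i + 1 then 0 else fps_nth (g ^ (Suc m + i)) (n - (2 * i + 1)))) (mon2 r p s q)" for i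
  have T_r: "T r = (if p = 0 then 0 else mon2_coeff g r s (Suc m + r) (p - 1) q)"
  proof (cases p)
    case 0
    then show ?thesis
      using rs unfolding T_def
      by (subst lookup_indet_mult_eq_0) (simp_all add: mon2_def lookup_add lookup_single)
  next
    case (Suc p')
    then have "\<not> n < 2 * r + 1" "n - (2 * r + 1) = p' * (2 * r + 1) + q * (2 * s + 1)"
      by (simp_all add: n_def)
    then show ?thesis
      unfolding T_def Suc by (simp add: lookup_indet_mult_mon2_left mon2_coeff_def)
  qed
  have T_s: "T s = (if q = 0 then 0 else mon2_coeff g r s (Suc m + s) p (q - 1))"
  proof (cases q)
    case 0
    then show ?thesis
      using rs unfolding T_def
      by (subst lookup_indet_mult_eq_0) (simp_all add: mon2_def lookup_add lookup_single)
  next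
    case (Suc q')
    then have "\<not> n < 2 * s + 1" "n - (2 * s + 1) = p * (2 * r + 1) + q' * (2 * s + 1)"
      by (simp_all add: n_def)
    then show ?thesis
      unfolding T_def Suc mon2_commute[of r p s]
      by (simp add: lookup_indet_mult_mon2_left mon2_coeff_def mon2_commute[of r p s])
  qed
  have "mon2_coeff g r s (Suc m) p q = mon2_coeff g r s m p q + (\<Sum>i\<le>n. T i)"
    unfolding mon2_coeff_def n_def[symmetric] T_def
    by (subst fps_power_Suc_nth_recurrence[OF g]) (simp add: lookup_add lookup_sum)
  \<comment> \<open>Neither index set need contain the other. For \<open>i > n\<close> the guard in
    \<open>T\<close> gives 0; for \<open>i\<close> other than \<open>r\<close> and \<open>s\<close>,
    \<open>indet i\<close> does not divide the monomial.\<close>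
  also have "(\<Sum>i\<le>n. T i) = (\<Sum>i\<in>{r, s}. T i)"
  proof (rule sum.mono_neutral_cong)
    show "T i = 0" if "i \<in> {r, s} - {..n}" for i
      using that by (auto simp: T_def)
    show "T i = 0" if "i \<in> {..n} - {r, s}" for i
      using that unfolding T_def
      by (intro lookup_indet_mult_eq_0) (auto simp: mon2_def lookup_add lookup_single)
  qed auto
  finally show ?thesis
    using rs T_r T_s by simp
qed

definition closed_form :: "nat \<Rightarrow> nat \<Rightarrow> nat \<Rightarrow> nat \<Rightarrow> nat \<Rightarrow> 'a::field_char_0" where
  "closed_form r s m p q = of_nat m * fact (m + p * (r + 1) + q * (s + 1) - 1)
     / (fact p * fact q * fact (m + p * r + q * s))"

text \<open>Over the common denominator \<open>D\<close> all four terms share the factor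
  \<open>fact t\<close>, which leaves a polynomial identity in natural numbers. The assumption makes
  \<open>d + p + q\<close> a successor; for \<open>m = p = q = 0\<close> the recurrence
  fails.\<close>

lemma closed_form_Suc:
  assumes "p > 0 \<or> q > 0"
  shows "(closed_form r s (Suc m) p q :: 'a::field_char_0) = closed_form r s m p q
     + (if p = 0 then 0 else closed_form r s (Suc m + r) (p - 1) q)
     + (if q = 0 then 0 else closed_form r s (Suc m + s) p (q - 1))"
proof -
  define d where "d = m + p * r + q * s"
  obtain t where t: "d + p + q = Suc t"
    using assms by (cases "d + p + q") auto
  define D :: 'a where "D = fact p * fact q * fact (Suc d)"
  have 1: "closed_form r s (Suc m) p q = of_nat (Suc m) * (of_nat (Suc t) * fact t) / D"
  proof -
    have "Suc m + p * (r + 1) + q * (s + 1) - 1 = Suc t" "Suc m + p * r + q * s = Suc d"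
      using t by (simp_all add: d_def)
    then show ?thesis unfolding closed_form_def D_def by (simp only: fact_Suc)
  qed
  have 2: "closed_form r s m p q = of_nat m * (of_nat (Suc d) * fact t) / D"
  proof -
    have "m + p * (r + 1) + q * (s + 1) - 1 = t" "m + p * r + q * s = d"
      using t by (simp_all add: d_def)
    moreover have "1 + of_nat d \<noteq> (0 :: 'a)"
      using of_nat_neq_0[of d] by simp
    ultimately show ?thesis unfolding closed_form_def D_def
      by simp
  qed
  \<comment> \<open>The factor \<open>p\<close> comes from raising \<open>fact (p - 1)\<close> to
    \<open>fact p\<close> in the denominator; it also covers \<open>p = 0\<close>.\<close>
  have 3: "(if p = 0 then 0 else closed_form r s (Suc m + r) (p - 1) q)
      = of_nat (Suc m + r) * (of_nat p * fact t) / D"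
  proof (cases p)
    case (Suc p')
    then have "Suc m + r + p' * (r + 1) + q * (s + 1) - 1 = t" "Suc m + r + p' * r + q * s = Suc d"
      using t by (simp_all add: d_def)
    then show ?thesis unfolding closed_form_def D_def Suc
      by (simp del: of_nat_Suc fact_Suc add: fact_Suc[of p'])
  qed simp
  have 4: "(if q = 0 then 0 else closed_form r s (Suc m + s) p (q - 1))
      = of_nat (Suc m + s) * (of_nat q * fact t) / D"
  proof (cases q)
    case (Suc q')
    then have "Suc m + s + p * (r + 1) + q' * (s + 1) - 1 = t" "Suc m + s + p * r + q' * s = Suc d"
      using t by (simp_all add: d_def)
    then show ?thesis unfolding closed_form_def D_def Suc
      by (simp del: of_nat_Suc fact_Suc add: fact_Suc[of q'])
  qed simp
  have "Suc m * Suc t = m * Suc d + (Suc m + r) * p + (Suc m + s) * q"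
    unfolding t[symmetric] by (simp add: d_def algebra_simps)
  then have "(of_nat (Suc m) * of_nat (Suc t) :: 'a)
      = of_nat m * of_nat (Suc d) + of_nat (Suc m + r) * of_nat p + of_nat (Suc m + s) * of_nat q"
    by (metis of_nat_add of_nat_mult)
  then show ?thesis
    unfolding 1 2 3 4 by (simp only: mult.assoc[symmetric] add_divide_distrib[symmetric] distrib_right[symmetric])
qed

lemma mon2_coeff_0:
  assumes "p > 0 \<or> q > 0"
  shows "mon2_coeff g r s 0 p q = 0"
  using assms by (auto simp: mon2_coeff_def)

lemma mon2_coeff_eq_closed_form:
  fixes g :: "'a::field_char_0 bpoly fps"
  assumes g: "g = 1 + fps_X * g * fps_compose B_series (fps_X\<^sup>2 * g)" and rs: "r \<noteq> s"
    and "m > 0"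
  shows "mon2_coeff g r s m p q = closed_form r s m p q"
  using \<open>m > 0\<close>
proof (induction "p + q" arbitrary: p q m)
  case 0
  \<comment> \<open>With \<open>p = q = 0\<close> the recurrence says that the value does not depend
    on \<open>m\<close>, and \<open>g ^ 0 = 1\<close> supplies it.\<close>
  have "mon2_coeff g r s m 0 0 = 1" for m
    by (induction m) (simp_all add: mon2_coeff_Suc[OF g rs], simp add: mon2_coeff_def mon2_def)
  moreover have "closed_form r s m 0 0 = (1 :: 'a)"
    using \<open>m > 0\<close> by (simp add: closed_form_def fact_reduce[of m])
  ultimately show ?case
    using 0 by simp
next
  case (Suc j)
  \<comment> \<open>This hypothesis holds for every positive exponent, as needed: lowering
    \<open>p\<close> or \<open>q\<close> raises \<open>m\<close> to \<open>Suc m + r\<close> or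
    \<open>Suc m + s\<close>.\<close>
  note IH = Suc.hyps
  have pos: "p > 0 \<or> q > 0"
    using Suc.hyps(2) by auto
  show ?case
  \<comment> \<open>The inner induction can start at \<open>m = 0\<close>, since both sides vanish
    there once \<open>p + q > 0\<close>. For \<open>p = q = 0\<close> they would be 1 and 0, whence
    the restriction to \<open>m > 0\<close>.\<close>
  proof (induction m)
    case 0
    show ?case by (simp add: mon2_coeff_0[OF pos] closed_form_def)
  next
    case (Suc m)
    show ?case
      unfolding mon2_coeff_Suc[OF g rs] closed_form_Suc[OF pos] Suc
      using IH by simp
  qed
qed

theorem theorem6:
  fixes g :: "'a::field_char_0 bpoly fps"
    and m r s m\<^sub>r m\<^sub>s k :: nat
  assumes g: "g = 1 + fps_X * g * fps_compose B_series (fps_X\<^sup>2 * g)"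
    and m: "m > 0"
    and rs: "r \<noteq> s"
    and k: "k = m\<^sub>r * (r + 1) + m\<^sub>s * (s + 1)"
  shows "Poly_Mapping.lookup
           (fps_nth (g ^ m) (m\<^sub>r * (2 * r + 1) + m\<^sub>s * (2 * s + 1))) (mon2 r m\<^sub>r s m\<^sub>s)
         = of_nat m / of_nat (m + k - m\<^sub>r - m\<^sub>s)
             * of_nat ((m + k - 1) choose m\<^sub>r) * of_nat ((m + k - 1 - m\<^sub>r) choose m\<^sub>s)
       \<and> of_nat m / of_nat (m + k - m\<^sub>r - m\<^sub>s)
             * of_nat ((m + k - 1) choose m\<^sub>r) * of_nat ((m + k - 1 - m\<^sub>r) choose m\<^sub>s)
         = (of_nat m * fact (m + k - 1)
             / (fact m\<^sub>r * fact m\<^sub>s * fact (m + k - m\<^sub>r - m\<^sub>s)) :: 'a)"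
proof -
  have d: "m + k - m\<^sub>r - m\<^sub>s = m + m\<^sub>r * r + m\<^sub>s * s"
    by (simp add: k)
  have "mon2_coeff g r s m m\<^sub>r m\<^sub>s
      = of_nat m * fact (m + k - 1) / (fact m\<^sub>r * fact m\<^sub>s * fact (m + k - m\<^sub>r - m\<^sub>s))"
    unfolding mon2_coeff_eq_closed_form[OF g rs m] closed_form_def d by (simp add: k add.assoc)
  moreover have "of_nat m / of_nat (m + k - m\<^sub>r - m\<^sub>s)
             * of_nat ((m + k - 1) choose m\<^sub>r) * of_nat ((m + k - 1 - m\<^sub>r) choose m\<^sub>s)
         = (of_nat m * fact (m + k - 1)
             / (fact m\<^sub>r * fact m\<^sub>s * fact (m + k - m\<^sub>r - m\<^sub>s)) :: 'a)"
  proof -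
    \<comment> \<open>The product of the binomials leaves \<open>fact e\<close> in the denominator,
      and the prefactor's \<open>Suc e\<close> completes it to \<open>fact (Suc e)\<close>.\<close>
    obtain e where e: "m + k - m\<^sub>r - m\<^sub>s = Suc e"
      using m d by (cases "m + k - m\<^sub>r - m\<^sub>s") auto
    then have *: "m + k - 1 - m\<^sub>r - m\<^sub>s = e" "m\<^sub>r \<le> m + k - 1" "m\<^sub>s \<le> m + k - 1 - m\<^sub>r"
      by auto
    show ?thesis
      unfolding binomial_fact[OF *(2)] binomial_fact[OF *(3)] *(1) e fact_Suc
      by (simp del: of_nat_Suc)
  qed
  ultimately show ?thesis
    by (simp add: mon2_coeff_def)
qed

end
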